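(* $(\mathrm{L}+(\mathrm{CS}))$-grammars recognize all permutations of regular languages: for every finite alphabet $\Sigma$ and every regular language $L\subseteq\Sigma^+$ (i.e. not containing the empty word), there exists an $(\mathrm{L}+(\mathrm{CS}))$-grammar $G$ over $\Sigma$ such that $L(G)=\mathrm{PERM}(L)$, where $\mathrm{PERM}(L)=\{a_{\sigma(1)}\dots a_{\sigma(n)}\mid a_1\dots a_n\in L,\ \sigma\in S_n\}$.
   Context: Types are built from primitive types (elements of a fixed infinite set $Pr$) using the binary connectives $\backslash$, $/$, $\cdot$. A sequent is $A_1,\dots,A_n\to B$ with $n\ge 1$ and $A_i,B$ types. Capital Latin letters denote types, $\Gamma,\Delta$ finite (possibly empty) sequences of types, $\Pi,\Psi$ nonempty finite sequences of types. The calculus $\mathrm{L}+(\mathrm{CS})$ is obtained from the Lambek calculus by adding the structural rule $(\mathrm{CS})$; its axioms and rules are: - $(\mathrm{Ax})$: $A\to A$. - $(\backslash\to)$: from $\Gamma,B,\Delta\to C$ and $\Pi\to A$ infer $\Gamma,\Pi,A\backslash B,\Delta\to C$. - $(\to\backslash)$: from $A,\Pi\to B$ infer $\Pi\to A\backslash B$. - $(/\to)$: from $\Gamma,B,\Delta\to C$ and $\Pi\to A$ infer $\Gamma,B/A,\Pi,\Delta\to C$. - $(\to/)$: from $\Pi,A\to B$ infer $\Pi\to B/A$. - $(\cdot\to)$: from $\Gamma,A,B,\Delta\to C$ infer $\Gamma,A\cdot B,\Delta\to C$. - $(\to\cdot)$: from $\Pi\to A$ and $\Psi\to B$ infer $\Pi,\Psi\to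 A\cdot B$. - $(\mathrm{cut})$: from $\Pi\to A$ and $\Gamma,A,\Delta\to B$ infer $\Gamma,\Pi,\Delta\to B$. - $(\mathrm{CS})$: from $\Pi,\Psi\to A$ infer $\Psi,\Pi\to A$. An $(\mathrm{L}+(\mathrm{CS}))$-grammar is a triple $G=\langle\Sigma,T,\triangleright\rangle$ where $\Sigma$ is a finite alphabet, $T$ is a distinguished type, and $\triangleright$ is a finite binary relation between $\Sigma$ and the set of types. The language recognized by $G$ is $L(G)=\{a_1\dots a_n\in\Sigma^+\mid \exists\text{ types }T_1,\dots,T_n:\ a_i\triangleright T_i\text{ for } i=1,\dots,n,\text{ and } T_1,\dots,T_n\to T\text{ is derivable in }\mathrm{L}+(\mathrm{CS})\}$. *)

theory Defs
  imports Main "HOL-Combinatorics.Permutations"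
begin

text \<open>
  Types over a set of primitive types, which is the type variable \<open>'p\<close>.
  \<open>Under A B\<close> is the left division (argument \<open>A\<close> on the left, result \<open>B\<close>) and
  \<open>Over B A\<close> is \<open>B / A\<close> (argument \<open>A\<close> on the right, result \<open>B\<close>).
\<close>

datatype 'p tp =
    Prim 'p
  | Under "'p tp" "'p tp"
  | Over "'p tp" "'p tp"
  | Prod "'p tp" "'p tp"

inductive derivable :: "'p tp list \<Rightarrow> 'p tp \<Rightarrow> bool"  (infix "\<turnstile>" 50) where
  Ax: "[A] \<turnstile> A"
| UnderL: "\<Gamma> @ [B] @ \<Delta> \<turnstile> C \<Longrightarrow> \<Phi> \<turnstile> A \<Longrightarrow> \<Phi> \<noteq> []
    \<Longrightarrow> \<Gamma> @ \<Phi> @ [Under A B] @ \<Delta> \<turnstile> C"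
| UnderR: "[A] @ \<Phi> \<turnstile> B \<Longrightarrow> \<Phi> \<noteq> [] \<Longrightarrow> \<Phi> \<turnstile> Under A B"
| OverL: "\<Gamma> @ [B] @ \<Delta> \<turnstile> C \<Longrightarrow> \<Phi> \<turnstile> A \<Longrightarrow> \<Phi> \<noteq> []
    \<Longrightarrow> \<Gamma> @ [Over B A] @ \<Phi> @ \<Delta> \<turnstile> C"
| OverR: "\<Phi> @ [A] \<turnstile> B \<Longrightarrow> \<Phi> \<noteq> [] \<Longrightarrow> \<Phi> \<turnstile> Over B A"
| ProdL: "\<Gamma> @ [A, B] @ \<Delta> \<turnstile> C \<Longrightarrow> \<Gamma> @ [Prod A B] @ \<Delta> \<turnstile> C"
| ProdR: "\<Phi> \<turnstile> A \<Longrightarrow> \<Psi> \<turnstile> B \<Longrightarrow> \<Phi> \<noteq> [] \<Longrightarrow> \<Psi> \<noteq> [] \<Longrightarrow> \<Phi> @ \<Psi> \<turnstile> Prod A B"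
| Cut: "\<Phi> \<turnstile> A \<Longrightarrow> \<Gamma> @ [A] @ \<Delta> \<turnstile> B \<Longrightarrow> \<Phi> \<noteq> [] \<Longrightarrow> \<Gamma> @ \<Phi> @ \<Delta> \<turnstile> B"
| CS: "\<Phi> @ \<Psi> \<turnstile> A \<Longrightarrow> \<Phi> \<noteq> [] \<Longrightarrow> \<Psi> \<noteq> [] \<Longrightarrow> \<Psi> @ \<Phi> \<turnstile> A"

lemma derivable_nonempty: "\<Phi> \<turnstile> A \<Longrightarrow> \<Phi> \<noteq> []"
  by (induction rule: derivable.induct) auto

record ('a, 'p) grammar =
  alphabet :: "'a set"
  distinguished :: "'p tp"
  assigns :: "('a \<times> 'p tp) set"

definition is_grammar :: "('a, 'p) grammar \<Rightarrow> bool" where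
  "is_grammar G \<longleftrightarrow>
     finite (alphabet G) \<and> finite (assigns G) \<and> assigns G \<subseteq> alphabet G \<times> UNIV"

definition language :: "('a, 'p) grammar \<Rightarrow> 'a list set" where
  "language G = {w \<in> lists (alphabet G). w \<noteq> [] \<and>
     (\<exists>Ts. list_all2 (\<lambda>a T. (a, T) \<in> assigns G) w Ts \<and> Ts \<turnstile> distinguished G)}"

text \<open>
  Regular languages over \<open>\<Sigma>\<close>, as the languages of complete deterministic finite automata.
  Taking the states to be natural numbers is no restriction (see \<open>regularI\<close> below).
\<close>

definition dfa_language ::
  "'a set \<Rightarrow> ('q \<Rightarrow> 'a \<Rightarrow> 'q) \<Rightarrow> 'q \<Rightarrow> 'q set \<Rightarrow> 'a list set" where
  "dfa_language \<Sigma> \<delta> q\<^sub>0 F = {w \<in> lists \<Sigma>. foldl \<delta> q\<^sub>0 w \<in> F}"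

definition is_dfa ::
  "'a set \<Rightarrow> 'q set \<Rightarrow> ('q \<Rightarrow> 'a \<Rightarrow> 'q) \<Rightarrow> 'q \<Rightarrow> 'q set \<Rightarrow> bool" where
  "is_dfa \<Sigma> Q \<delta> q\<^sub>0 F \<longleftrightarrow>
     finite Q \<and> q\<^sub>0 \<in> Q \<and> F \<subseteq> Q \<and> (\<forall>q\<in>Q. \<forall>a\<in>\<Sigma>. \<delta> q a \<in> Q)"

definition regular :: "'a set \<Rightarrow> 'a list set \<Rightarrow> bool" where
  "regular \<Sigma> L \<longleftrightarrow> (\<exists>(Q :: nat set) \<delta> q\<^sub>0 F. is_dfa \<Sigma> Q \<delta> q\<^sub>0 F \<and> L = dfa_language \<Sigma> \<delta> q\<^sub>0 F)"

lemma regularI: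
  fixes Q :: "'q set"
  assumes "is_dfa \<Sigma> Q \<delta> q\<^sub>0 F"
  shows "regular \<Sigma> (dfa_language \<Sigma> \<delta> q\<^sub>0 F)"
proof -
  obtain f :: "'q \<Rightarrow> nat" where inj: "inj_on f Q"
    using assms finite_imp_inj_to_nat_seg[of Q] by (auto simp: is_dfa_def)
  define g where "g = inv_into Q f"
  define \<delta>' where "\<delta>' = (\<lambda>n a. f (\<delta> (g n) a))"
  have g: "g (f q) = q" if "q \<in> Q" for q
    using that inj by (simp add: g_def)
  have run: "foldl \<delta>' (f q) w = f (foldl \<delta> q w) \<and> foldl \<delta> q w \<in> Q"
    if "q \<in> Q" "w \<in> lists \<Sigma>" for q w
    using that(2,1)
  proof (induction w arbitrary: q)
    case Nil
    then show ?case by simp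
  next
    case (Cons a w)
    then have "\<delta> q a \<in> Q"
      using assms by (simp add: is_dfa_def)
    moreover have "\<delta>' (f q) a = f (\<delta> q a)"
      using Cons.prems by (simp add: \<delta>'_def g)
    ultimately show ?case
      using Cons.IH by simp
  qed
  have "is_dfa \<Sigma> (f ` Q) \<delta>' (f q\<^sub>0) (f ` F)"
    unfolding is_dfa_def
  proof (intro conjI ballI)
    show "finite (f ` Q)" "f q\<^sub>0 \<in> f ` Q" "f ` F \<subseteq> f ` Q"
      using assms by (auto simp: is_dfa_def)
    fix n a
    assume "n \<in> f ` Q" "a \<in> \<Sigma>"
    then show "\<delta>' n a \<in> f ` Q"
      using assms g by (auto simp: is_dfa_def \<delta>'_def)
  qed
  moreover have "dfa_language \<Sigma> \<delta> q\<^sub>0 F = dfa_language \<Sigma> \<delta>' (f q\<^sub>0) (f ` F)"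
  proof -
    have "q\<^sub>0 \<in> Q" "F \<subseteq> Q"
      using assms by (simp_all add: is_dfa_def)
    then have "foldl \<delta>' (f q\<^sub>0) w \<in> f ` F \<longleftrightarrow> foldl \<delta> q\<^sub>0 w \<in> F" if "w \<in> lists \<Sigma>" for w
      using run[of q\<^sub>0 w] that by (simp add: inj_on_image_mem_iff[OF inj])
    then show ?thesis
      unfolding dfa_language_def by blast
  qed
  ultimately show ?thesis
    unfolding regular_def by blast
qed

definition PERM :: "'a list set \<Rightarrow> 'a list set" where
  "PERM L = {permute_list \<sigma> w | \<sigma> w. w \<in> L \<and> \<sigma> permutes {..<length w}}"

end

(*
  Commutativity of the product together with cut makes the full permutation rule derivable from
  the cyclic shift rule.  A transition from p to q on the letter a is encoded by a type p \ q of a,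
  and, if q is final, also by a type p \ f of a, where f is a fresh primitive type; the
  distinguished type is q0 \ f.  That only permutations of accepted words are recognized follows
  from soundness for a model in the commutative monoid of multisets of letters: a state q denotes
  the letter counts of the words leading from q0 to q, and f those of the words of L.
*)

theory Submission
  imports Defs
begin

section \<open>The permutation rule\<close>

text \<open>Cyclic shift rotates a whole antecedent only. Applied to the two-formula sequent that
  introduces \<open>Prod A B\<close>, it exchanges just \<open>A\<close> and \<open>B\<close>, and
  cut transfers this exchange into any context.\<close>

lemma derivable_swap:
  assumes "\<Gamma> @ [A, B] @ \<Delta> \<turnstile> C"
  shows "\<Gamma> @ [B, A] @ \<Delta> \<turnstile> C"
proof -
  have "[A] @ [B] \<turnstile> Prod A B"
    by (intro ProdR Ax) auto
  then have "[B] @ [A] \<turnstile> Prod A B"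
    by (rule CS) auto
  then show ?thesis
    using Cut[of "[B, A]" "Prod A B" \<Gamma> \<Delta> C] ProdL[OF assms] by simp
qed

lemma derivable_move_right:
  "\<Gamma> @ \<Phi> @ [A] @ \<Delta> \<turnstile> C \<Longrightarrow> \<Gamma> @ [A] @ \<Phi> @ \<Delta> \<turnstile> C"
proof (induction \<Phi> arbitrary: \<Gamma>)
  case Nil
  then show ?case by simp
next
  case (Cons B \<Phi>)
  then have "\<Gamma> @ [B, A] @ \<Phi> @ \<Delta> \<turnstile> C"
    using Cons.IH[of "\<Gamma> @ [B]"] by simp
  then show ?case
    using derivable_swap[of \<Gamma> B A "\<Phi> @ \<Delta>" C] by simp
qed

text \<open>The prefix \<open>\<Gamma>\<close> collects the formulas already in place: each head of
  \<open>\<Psi>\<close> is located in \<open>\<Phi>\<close>, brought to the front and appended to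
  \<open>\<Gamma>\<close>.\<close>

lemma derivable_permute_context:
  "\<Gamma> @ \<Phi> \<turnstile> C \<Longrightarrow> mset \<Phi> = mset \<Psi> \<Longrightarrow> \<Gamma> @ \<Psi> \<turnstile> C"
proof (induction \<Psi> arbitrary: \<Gamma> \<Phi>)
  case Nil
  then show ?case by simp
next
  case (Cons A \<Psi>)
  then have "A \<in> set \<Phi>"
    by (metis list.set_intros(1) set_mset_mset)
  then obtain X Y where \<Phi>: "\<Phi> = X @ [A] @ Y"
    by (auto dest: split_list)
  then have "(\<Gamma> @ [A]) @ X @ Y \<turnstile> C"
    using derivable_move_right[of \<Gamma> X A Y C] Cons.prems(1) by simp
  moreover have "mset (X @ Y) = mset \<Psi>"
    using Cons.prems(2) \<Phi> by simp
  ultimately show ?case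
    using Cons.IH[of "\<Gamma> @ [A]" "X @ Y"] by simp
qed

lemma derivable_permute:
  "\<Phi> \<turnstile> C \<Longrightarrow> mset \<Phi> = mset \<Psi> \<Longrightarrow> \<Psi> \<turnstile> C"
  using derivable_permute_context[of "[]"] by simp

section \<open>Models in commutative monoids\<close>

text \<open>Powerset model: divisions are residuals of the elementwise sum of sets, and the product
  is that sum.\<close>

primrec interp :: "('p \<Rightarrow> 'm set) \<Rightarrow> 'p tp \<Rightarrow> 'm::comm_monoid_add set" where
  "interp V (Prim x) = V x"
| "interp V (Under A B) = {m. \<forall>x\<in>interp V A. x + m \<in> interp V B}"
| "interp V (Over B A) = {m. \<forall>x\<in>interp V A. m + x \<in> interp V B}"
| "interp V (Prod A B) = {x + y |x y. x \<in> interp V A \<and> y \<in> interp V B}"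

primrec interps :: "('p \<Rightarrow> 'm set) \<Rightarrow> 'p tp list \<Rightarrow> 'm::comm_monoid_add set" where
  "interps V [] = {0}"
| "interps V (A # \<Gamma>) = {x + y |x y. x \<in> interp V A \<and> y \<in> interps V \<Gamma>}"

lemma interps_append:
  "interps V (\<Gamma> @ \<Delta>) = {x + y |x y. x \<in> interps V \<Gamma> \<and> y \<in> interps V \<Delta>}"
proof (induction \<Gamma>)
  case Nil
  then show ?case by simp
next
  case (Cons A \<Gamma>)
  then show ?case
    by (auto simp: add.assoc) (metis add.assoc)+
qed

lemma interps_sum_list:
  "list_all2 (\<lambda>m A. m \<in> interp V A) ms \<Gamma> \<Longrightarrow> sum_list ms \<in> interps V \<Gamma>"
  by (induction rule: list_all2_induct) auto

text \<open>The division rules hold by residuation and reassociation of sums; commutativity of the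
  monoid is what validates the cyclic shift.\<close>

theorem soundness:
  fixes V :: "'p \<Rightarrow> 'm::comm_monoid_add set"
  shows "\<Gamma> \<turnstile> A \<Longrightarrow> interps V \<Gamma> \<subseteq> interp V A"
proof (induction rule: derivable.induct)
  case (Ax A)
  then show ?case by auto
next
  case (UnderL \<Gamma> B \<Delta> C \<Phi> A)
  show ?case
  proof
    fix m
    assume "m \<in> interps V (\<Gamma> @ \<Phi> @ [Under A B] @ \<Delta>)"
    then obtain g p u d where m: "m = g + (p + (u + d))"
      and mem: "g \<in> interps V \<Gamma>" "p \<in> interps V \<Phi>" "u \<in> interp V (Under A B)" "d \<in> interps V \<Delta>"
      by (auto simp: interps_append)
    then have "p + u \<in> interp V B"
      using UnderL.IH(2) by auto
    then have "g + ((p + u) + d) \<in> interps V (\<Gamma> @ [B] @ \<Delta>)"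
      using mem unfolding interps_append by fastforce
    then show "m \<in> interp V C"
      using UnderL.IH(1) m by (auto simp: add.assoc)
  qed
next
  case (UnderR A \<Phi> B)
  then show ?case by auto
next
  case (OverL \<Gamma> B \<Delta> C \<Phi> A)
  show ?case
  proof
    fix m
    assume "m \<in> interps V (\<Gamma> @ [Over B A] @ \<Phi> @ \<Delta>)"
    then obtain g p u d where m: "m = g + (u + (p + d))"
      and mem: "g \<in> interps V \<Gamma>" "p \<in> interps V \<Phi>" "u \<in> interp V (Over B A)" "d \<in> interps V \<Delta>"
      by (auto simp: interps_append)
    then have "u + p \<in> interp V B"
      using OverL.IH(2) by auto
    then have "g + ((u + p) + d) \<in> interps V (\<Gamma> @ [B] @ \<Delta>)"
      using mem unfolding interps_append by fastforce
    then show "m \<in> interp V C"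
      using OverL.IH(1) m by (auto simp: add.assoc)
  qed
next
  case (OverR \<Phi> A B)
  then show ?case by (fastforce simp: interps_append)
next
  case (ProdL \<Gamma> A B \<Delta> C)
  have "interps V (\<Gamma> @ [Prod A B] @ \<Delta>) \<subseteq> interps V (\<Gamma> @ [A, B] @ \<Delta>)"
    by (simp add: interps_append) (auto, metis add.assoc)
  then show ?case
    using ProdL.IH by blast
next
  case (ProdR \<Phi> A \<Psi> B)
  then show ?case by (fastforce simp: interps_append)
next
  case (Cut \<Phi> A \<Gamma> \<Delta> B)
  have "interps V (\<Gamma> @ \<Phi> @ \<Delta>) \<subseteq> interps V (\<Gamma> @ [A] @ \<Delta>)"
    using Cut.IH(1) by (fastforce simp: interps_append)
  then show ?case
    using Cut.IH(2) by blast
next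
  case (CS \<Phi> \<Psi> A)
  have "interps V (\<Psi> @ \<Phi>) \<subseteq> interps V (\<Phi> @ \<Psi>)"
    by (auto simp: interps_append) (metis add.commute)
  then show ?case
    using CS.IH by blast
qed

section \<open>The grammar of an automaton\<close>

text \<open>Two lists are permutations of each other exactly when their multisets agree, so letter
  counts alone decide membership.\<close>

lemma PERM_iff: "w \<in> PERM L \<longleftrightarrow> (\<exists>v\<in>L. mset w = mset v)"
proof
  assume "w \<in> PERM L"
  then show "\<exists>v\<in>L. mset w = mset v"
    by (auto simp: PERM_def intro: mset_permute_list)
next
  assume "\<exists>v\<in>L. mset w = mset v"
  then obtain v where v: "v \<in> L" "mset w = mset v"
    by blast
  then obtain \<sigma> where "\<sigma> permutes {..<length v}" "permute_list \<sigma> v = w"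
    by (auto elim: mset_eq_permutation)
  with v show "w \<in> PERM L"
    by (auto simp: PERM_def)
qed

text \<open>The one goal primitive \<open>f\<close> serves all final states. A letter leading into
  \<open>F\<close> keeps its ordinary type too, since a run may pass through a final state and go
  on.\<close>

definition transition_types ::
  "'a set \<Rightarrow> 'q set \<Rightarrow> ('q \<Rightarrow> 'a \<Rightarrow> 'q) \<Rightarrow> 'q set \<Rightarrow> ('q \<Rightarrow> 'p) \<Rightarrow> 'p \<Rightarrow> ('a \<times> 'p tp) set" where
  "transition_types \<Sigma> Q \<delta> F s f =
     {(a, Under (Prim (s q)) (Prim (s (\<delta> q a)))) |a q. a \<in> \<Sigma> \<and> q \<in> Q} \<union>
     {(a, Under (Prim (s q)) (Prim f)) |a q. a \<in> \<Sigma> \<and> q \<in> Q \<and> \<delta> q a \<in> F}"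

lemma finite_transition_types:
  assumes "finite \<Sigma>" "finite Q"
  shows "finite (transition_types \<Sigma> Q \<delta> F s f)"
proof (rule finite_subset)
  show "transition_types \<Sigma> Q \<delta> F s f \<subseteq>
      (\<lambda>(a, q). (a, Under (Prim (s q)) (Prim (s (\<delta> q a))))) ` (\<Sigma> \<times> Q) \<union>
      (\<lambda>(a, q). (a, Under (Prim (s q)) (Prim f))) ` (\<Sigma> \<times> Q)"
    by (auto simp: transition_types_def)
qed (use assms in simp)

text \<open>The types follow the run: each consumes the primitive of the current state and leaves
  that of the next one, and the last letter yields \<open>f\<close> instead.\<close>

lemma accepted_derivable:
  assumes "\<forall>q\<in>Q. \<forall>a\<in>\<Sigma>. \<delta> q a \<in> Q"
  shows "v \<in> lists \<Sigma> \<Longrightarrow> v \<noteq> [] \<Longrightarrow> q \<in> Q \<Longrightarrow> foldl \<delta> q v \<in> F \<Longrightarrow>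
    \<exists>Ts. list_all2 (\<lambda>a T. (a, T) \<in> transition_types \<Sigma> Q \<delta> F s f) v Ts \<and>
      [Prim (s q)] @ Ts \<turnstile> Prim f"
proof (induction v arbitrary: q)
  case Nil
  then show ?case by simp
next
  case (Cons a v)
  \<comment> \<open>With an empty left context and an axiom as minor premise, the rule reads: from
    \<open>B # \<Delta> \<turnstile> C\<close> infer
    \<open>A # Under A B # \<Delta> \<turnstile> C\<close>.\<close>
  note step = UnderL[of "[]", OF _ Ax, simplified]
  show ?case
  proof (cases "v = []")
    case True
    have "[Prim (s q), Under (Prim (s q)) (Prim f)] \<turnstile> Prim f"
      by (rule step) (rule Ax)
    moreover have "(a, Under (Prim (s q)) (Prim f)) \<in> transition_types \<Sigma> Q \<delta> F s f"
      using Cons.prems True by (auto simp: transition_types_def)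
    ultimately show ?thesis
      using True by (intro exI[of _ "[Under (Prim (s q)) (Prim f)]"]) simp
  next
    case False
    then obtain Ts where Ts: "list_all2 (\<lambda>a T. (a, T) \<in> transition_types \<Sigma> Q \<delta> F s f) v Ts"
        "[Prim (s (\<delta> q a))] @ Ts \<turnstile> Prim f"
      using Cons.IH[of "\<delta> q a"] Cons.prems assms by auto
    let ?T = "Under (Prim (s q)) (Prim (s (\<delta> q a)))"
    have "(a, ?T) \<in> transition_types \<Sigma> Q \<delta> F s f"
      using Cons.prems by (auto simp: transition_types_def)
    moreover have "[Prim (s q)] @ ?T # Ts \<turnstile> Prim f"
      using step Ts(2) by simp
    ultimately show ?thesis
      using Ts(1) by (intro exI[of _ "?T # Ts"]) simp
  qed
qed

lemma recognized_accepted: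
  fixes s :: "'q \<Rightarrow> 'p"
  assumes types: "list_all2 (\<lambda>a T. (a, T) \<in> transition_types \<Sigma> Q \<delta> F s f) w Ts"
    and der: "Ts \<turnstile> Under (Prim (s q\<^sub>0)) (Prim f)"
    and "inj s" "f \<notin> range s"
  shows "\<exists>v \<in> dfa_language \<Sigma> \<delta> q\<^sub>0 F. mset w = mset v"
proof -
  define V where "V = (\<lambda>x. if x = f then mset ` dfa_language \<Sigma> \<delta> q\<^sub>0 F
    else {mset v |v. v \<in> lists \<Sigma> \<and> s (foldl \<delta> q\<^sub>0 v) = x})"
  have V_f: "V f = mset ` dfa_language \<Sigma> \<delta> q\<^sub>0 F"
    by (simp add: V_def)
  \<comment> \<open>Freshness of \<open>f\<close> selects the second branch of \<open>V\<close>, and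
    injectivity of \<open>s\<close> recovers the state from its name.\<close>
  have V_s: "V (s q) = {mset v |v. v \<in> lists \<Sigma> \<and> foldl \<delta> q\<^sub>0 v = q}" for q
    using assms(3,4) by (auto simp: V_def inj_eq)
  have letter: "{#a#} \<in> interp V T" if "(a, T) \<in> transition_types \<Sigma> Q \<delta> F s f" for a T
    using that unfolding transition_types_def
  proof (elim UnE CollectE exE conjE, goal_cases)
    case (1 b q)
    \<comment> \<open>If \<open>v\<close> leads to \<open>q\<close>, then \<open>v @ [a]\<close>
      leads to \<open>\<delta> q a\<close>; the same word is accepted in the second case, where
      \<open>\<delta> q a\<close> is final.\<close>
    have "\<exists>u. mset v + {#a#} = mset u \<and> u \<in> lists \<Sigma> \<and> foldl \<delta> q\<^sub>0 u = \<delta> q a"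
      if "v \<in> lists \<Sigma>" "foldl \<delta> q\<^sub>0 v = q" for v
      using that 1 by (intro exI[of _ "v @ [a]"]) simp
    with 1 show ?case
      by (auto simp: V_s simp del: mset_append)
  next
    case (2 b q)
    have "mset v + {#a#} \<in> mset ` dfa_language \<Sigma> \<delta> q\<^sub>0 F"
      if "v \<in> lists \<Sigma>" "foldl \<delta> q\<^sub>0 v = q" for v
      using that 2 by (intro image_eqI[of _ _ "v @ [a]"]) (simp_all add: dfa_language_def)
    with 2 show ?case
      by (auto simp: V_s V_f)
  qed
  have "list_all2 (\<lambda>m A. m \<in> interp V A) (map (\<lambda>a. {#a#}) w) Ts"
    using types by (auto simp: list_all2_map1 intro: letter elim: list_all2_mono)
  then have "sum_list (map (\<lambda>a. {#a#}) w) \<in> interp V (Under (Prim (s q\<^sub>0)) (Prim f))"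
    using interps_sum_list soundness[OF der] by blast
  moreover have "sum_list (map (\<lambda>a. {#a#}) w) = mset w"
    by (induction w) auto
  \<comment> \<open>The empty word leads from \<open>q\<^sub>0\<close> to itself. Feeding its
    multiset to the division adds no letters, so \<open>mset w\<close> itself lands in
    \<open>V f\<close>.\<close>
  moreover have "{#} \<in> V (s q\<^sub>0)"
    by (auto simp: V_s intro: exI[of _ "[]"])
  ultimately have "mset w \<in> V f"
    by force
  then show ?thesis
    by (auto simp: V_f)
qed

theorem theorem7:
  fixes \<Sigma> :: "'a set" and L :: "'a list set"
  assumes "infinite (UNIV :: 'p set)"
    and "finite \<Sigma>"
    and "regular \<Sigma> L"
    and "[] \<notin> L"
  shows "\<exists>G :: ('a, 'p) grammar.
           is_grammar G \<and> alphabet G = \<Sigma> \<and> language G = PERM L"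
proof -
  obtain Q :: "nat set" and \<delta> q\<^sub>0 F where dfa: "is_dfa \<Sigma> Q \<delta> q\<^sub>0 F"
    and L: "L = dfa_language \<Sigma> \<delta> q\<^sub>0 F"
    using assms(3) by (auto simp: regular_def)
  obtain e :: "nat \<Rightarrow> 'p" where e: "inj e"
    using infinite_countable_subset[OF assms(1)] by blast
  \<comment> \<open>The shift by \<open>Suc\<close> keeps \<open>e 0\<close> free to be the fresh
    primitive \<open>f\<close>.\<close>
  define s where "s q = e (Suc q)" for q
  define f where "f = e 0"
  have s: "inj s" "f \<notin> range s"
    using e by (auto simp: s_def f_def inj_def)
  define R where "R = transition_types \<Sigma> Q \<delta> F s f"
  define G where "G = \<lparr>alphabet = \<Sigma>, distinguished = Under (Prim (s q\<^sub>0)) (Prim f), assigns = R\<rparr>"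
  have "is_grammar G"
    using assms(2) dfa finite_transition_types[of \<Sigma> Q \<delta> F s f]
    by (auto simp: is_grammar_def is_dfa_def G_def R_def transition_types_def)
  moreover have "w \<in> language G \<longleftrightarrow> w \<in> PERM L" for w
  proof
    assume "w \<in> language G"
    then show "w \<in> PERM L"
      unfolding PERM_iff L
      using recognized_accepted[OF _ _ s] by (auto simp: language_def G_def R_def)
  next
    assume "w \<in> PERM L"
    then obtain v where v: "v \<in> L" "mset w = mset v"
      by (auto simp: PERM_iff)
    have "v \<noteq> []"
      using assms(4) v(1) by blast
    then obtain Ts where Ts: "list_all2 (\<lambda>a T. (a, T) \<in> R) v Ts" "[Prim (s q\<^sub>0)] @ Ts \<turnstile> Prim f"
      using accepted_derivable[of Q \<Sigma> \<delta> v q\<^sub>0 F s f] v(1) dfa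
      by (auto simp: L dfa_language_def is_dfa_def R_def)
    \<comment> \<open>The types of \<open>v\<close> are rearranged together with its letters, which
      assigns to \<open>w\<close> a permutation of \<open>Ts\<close>.\<close>
    obtain Us where Us: "list_all2 (\<lambda>a T. (a, T) \<in> R) w Us" "mset Us = mset Ts"
      using list_all2_reorder_left_invariance[OF Ts(1) v(2)] by blast
    \<comment> \<open>The right rule for \<open>Under\<close> demands a nonempty antecedent; this is
      where \<open>[] \<notin> L\<close> matters.\<close>
    have "Ts \<noteq> []"
      using Ts(1) \<open>v \<noteq> []\<close> by auto
    then have "Ts \<turnstile> Under (Prim (s q\<^sub>0)) (Prim f)"
      using Ts(2) by (intro UnderR)
    then have "Us \<turnstile> Under (Prim (s q\<^sub>0)) (Prim f)"
      using Us(2) by (auto intro: derivable_permute)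
    moreover have "set w = set v"
      using v(2) by (rule mset_eq_setD)
    then have "w \<in> lists \<Sigma>" "w \<noteq> []"
      using v(1) \<open>v \<noteq> []\<close> by (auto simp: L dfa_language_def)
    ultimately show "w \<in> language G"
      using Us(1) by (auto simp: language_def G_def)
  qed
  ultimately show ?thesis
    by (intro exI[of _ G]) (auto simp: G_def)
qed

end
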